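(* Let $m,n,r$ be positive integers with $r<\min\{m,n\}$, let $f:\mathbb{R}^{m\times n}\to\mathbb{R}$ be differentiable with locally Lipschitz continuous gradient, and let $0<\underline{\alpha}\le\overline{\alpha}<\infty$, $\beta,c\in(0,1)$, $\kappa_1\in(0,\frac12]$, $\kappa_2\in(0,1]$, $\Delta\in(0,\infty)$. Let $(X_i)_{i\in\mathbb{N}}$ be an (infinite) sequence generated by the $\mathrm{ERFDR}$ algorithm with these parameters. Write $\mathrm{s}(X)$ for $\mathrm{s}(X;f,\mathbb{R}^{m\times n}_{\le r})$. (a) If a subsequence $(X_{i_k})_{k\in\mathbb{N}}$ is bounded, then $$\rho:=\sup_{l\in\mathbb{N}}\Big(\|X_{i_l}-X_0\|+\frac{\overline{\alpha}}{\kappa_2}\|\nabla f(X_{i_l})\|\Big)<\infty$$ and, for all $k\in\mathbb{N}$, $$\sum_{l=0}^k\mathrm{s}(X_{i_l})^2<\frac{f(X_0)-\inf_{l\in\mathbb{N}}f(X_{i_l})}{c\,\kappa_1\min\Big\{\underline{\alpha},\frac{2\beta\kappa_2(1-c)}{\operatorname{Lip}_{B[X_0,\rho]}(\nabla f)}\Big\}},$$ thus $\lim_{l\to\infty}\mathrm{s}(X_{i_l})=0$ and, for all $k\in\mathbb{N}$, $$\min_{l\in\{0,\dots,k\}}\mathrm{s}(X_{i_l})<\frac{1}{\sqrt{k+1}}\sqrt{\frac{f(X_0)-\inf_{l\in\mathbb{N}}f(X_{i_l})}{c\,\kappa_1\min\Big\{\underline{\alpha},\frac{2\beta\kappa_2(1-c)}{\operatorname{Lip}_{B[X_0,\rho]}(\nabla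 f)}\Big\}}}.$$ If, moreover, $(X_{i_k})_{k\in\mathbb{N}}$ converges to $X\in\mathbb{R}^{m\times n}_{\le r}$, then $\inf_{l\in\mathbb{N}}f(X_{i_l})=f(X)$. (b) If $(X_i)_{i\in\mathbb{N}}$ is bounded, which is the case if the sublevel set $\{X\in\mathbb{R}^{m\times n}_{\le r}: f(X)\le f(X_0)\}$ is bounded, then all accumulation points of $(X_i)_{i\in\mathbb{N}}$ have the same image by $f$ and, for all $\varepsilon\in(0,\infty)$, with $\rho:=\sup_{j\in\mathbb{N}}\big(\|X_j-X_0\|+\frac{\overline{\alpha}}{\kappa_2}\|\nabla f(X_j)\|\big)$, $$i_\varepsilon:=\min\{i\in\mathbb{N}:\mathrm{s}(X_i)\le\varepsilon\}\le\left\lceil\frac{f(X_0)-\inf_{j\in\mathbb{N}}f(X_j)}{\varepsilon^2c\,\kappa_1\min\Big\{\underline{\alpha},\frac{2\beta\kappa_2(1-c)}{\operatorname{Lip}_{B[X_0,\rho]}(\nabla f)}\Big\}}\right\rceil-1.$$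
   Context: $\mathbb{R}^{m\times n}$ carries the Frobenius inner product $\langle X,Y\rangle=\operatorname{tr}(Y^\top X)$ and Frobenius norm $\|\cdot\|$. $B[X,\rho]=\{Y:\|X-Y\|\le\rho\}$. $\mathbb{R}^{m\times n}_{\le r}=\{X:\operatorname{rank}X\le r\}$, $\mathbb{R}^{m\times n}_{r-1}=\{X:\operatorname{rank}X=r-1\}$; $\sigma_1(X)\ge\dots\ge\sigma_{\min\{m,n\}}(X)\ge0$ are the singular values of $X$. For a closed ball $\mathcal{B}\subsetneq\mathbb{R}^{m\times n}$, $\operatorname{Lip}_{\mathcal{B}}(\nabla f)=\sup_{X,Y\in\mathcal{B},X\ne Y}\|\nabla f(X)-\nabla f(Y)\|/\|X-Y\|$; locally Lipschitz continuous gradient means this is finite for every closed ball. If $\operatorname{Lip}_{\mathcal{B}}(\nabla f)=0$, a positive number divided by it is read as $+\infty$ (so the minimum equals $\underline{\alpha}$). For nonempty $\mathcal{S}\subseteq\mathbb{R}^{m\times n}$, $P_{\mathcal{S}}(X)=\operatorname{argmin}_{Y\in\mathcal{S}}\|X-Y\|$ (a set). $\mathbb{N}$ includes $0$. Tangent cone: for $X\in\mathcal{S}$, $T_{\mathcal{S}}(X)$ is the set of all $Z$ for which there are sequences $(X_i)$ in $\mathcal{S}$ converging to $X$ and $(t_i)$ in $(0,\infty)$ with $(X_i-X)/t_i\to Z$. It is a closed cone. All elements of the projection of a given point onto a closed cone have the same norm. $\mathrm{s}(X;f,\mathbb{R}^{m\times n}_{\le r})$ is the common norm of the elements of $P_{T_{\mathbb{R}^{m\times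 n}_{\le r}}(X)}(-\nabla f(X))$. $\mathrm{ERFD}$ map with parameters $(f,r,\underline{\alpha},\overline{\alpha},\beta,c,\kappa_1,\kappa_2)$. Input $X\in\mathbb{R}^{m\times n}_{\le r}$. (1) Choose any $G\in\mathbb{R}^{m\times n}$ such that $\langle G,-\nabla f(X)\rangle\ge\max\{\kappa_1\,\mathrm{s}(X;f,\mathbb{R}^{m\times n}_{\le r})^2,\ \kappa_2\|G\|^2\}$ and $X+\alpha G\in\mathbb{R}^{m\times n}_{\le r}$ for all $\alpha\in[0,\overline{\alpha}]$. (2) Choose any $\alpha\in[\underline{\alpha},\overline{\alpha}]$. (3) While $f(X+\alpha G)>f(X)+c\,\alpha\langle\nabla f(X),G\rangle$, replace $\alpha$ by $\alpha\beta$. (4) Return $X+\alpha G$. The set of all possible outputs is $\mathrm{ERFD}(X;f,r,\underline{\alpha},\overline{\alpha},\beta,c,\kappa_1,\kappa_2)$. $\mathrm{ERFDR}$ map with the additional parameter $\Delta\in(0,\infty)$. Input $X\in\mathbb{R}^{m\times n}_{\le r}$. Choose $\tilde X\in\mathrm{ERFD}(X;f,r,\underline{\alpha},\overline{\alpha},\beta,c,\kappa_1,\kappa_2)$. If $\sigma_r(X)\in(0,\Delta]$, choose $\hat X\in P_{\mathbb{R}^{m\times n}_{r-1}}(X)$ and $\tilde X^{\mathrm R}\in\mathrm{ERFD}(\hat X;f,r,\underline{\alpha},\overline{\alpha},\beta,c,\kappa_1,\kappa_2)$, and return some $Y\in\operatorname{argmin}_{\{\tilde X,\tilde X^{\mathrm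 R}\}}f$; otherwise return $\tilde X$. The set of all possible outputs is $\mathrm{ERFDR}(X;f,r,\underline{\alpha},\overline{\alpha},\beta,c,\kappa_1,\kappa_2,\Delta)$. $\mathrm{ERFDR}$ algorithm. Starting from $X_0\in\mathbb{R}^{m\times n}_{\le r}$ and $i=0$: while $\mathrm{s}(X_i;f,\mathbb{R}^{m\times n}_{\le r})>0$, choose any $\Delta_i\in[\Delta,\infty)$, choose any $X_{i+1}\in\mathrm{ERFDR}(X_i;f,r,\underline{\alpha},\overline{\alpha},\beta,c,\kappa_1,\kappa_2,\Delta_i)$, and increment $i$. The sequence is infinite if and only if the loop never terminates, in which case $\mathrm{s}(X_i;f,\mathbb{R}^{m\times n}_{\le r})>0$ for all $i$. *)

theory Defs
  imports
    "HOL-Analysis.Analysis"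
    "HOL-Computational_Algebra.Computational_Algebra"
    "HOL-Library.While_Combinator"
begin

text \<open>
  An \<open>m \<times> n\<close> matrix is an element of type \<open>real^'n^'m\<close>; the library's \<open>inner\<close> and \<open>norm\<close> on this type
  are the Frobenius inner product and norm.
\<close>

lemma inner_eq_trace: "X \<bullet> Y = trace (transpose Y ** X)" for X Y :: "real^'n^'m"
proof -
  have "trace (transpose Y ** X) = (\<Sum>j\<in>UNIV. \<Sum>i\<in>UNIV. Y $ i $ j * X $ i $ j)"
    by (simp add: trace_def matrix_matrix_mult_def transpose_def)
  also have "\<dots> = (\<Sum>i\<in>UNIV. \<Sum>j\<in>UNIV. Y $ i $ j * X $ i $ j)"
    by (rule sum.swap)
  also have "\<dots> = X \<bullet> Y"
    by (simp add: inner_vec_def mult.commute)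
  finally show ?thesis by simp
qed


subsection \<open>Gradient and Lipschitz constant\<close>

definition grad :: "('a::euclidean_space \<Rightarrow> real) \<Rightarrow> 'a \<Rightarrow> 'a" where
  "grad f X = (THE D. GDERIV f X :> D)"

lemma GDERIV_grad:
  fixes f :: "'a::euclidean_space \<Rightarrow> real"
  assumes "f differentiable (at X)"
  shows "GDERIV f X :> grad f X"
proof -
  obtain f' where f': "(f has_derivative f') (at X)"
    using assms by (auto simp: differentiable_def)
  interpret bounded_linear f' using f' by (rule has_derivative_bounded_linear)
  have "f' = (\<lambda>h. h \<bullet> adjoint f' 1)"
    using adjoint_works[OF linear_axioms] by (auto simp: fun_eq_iff inner_real_def)
  then have D: "GDERIV f X :> adjoint f' 1"
    using f' unfolding gderiv_def by metis
  have "E = adjoint f' 1" if "GDERIV f X :> E" for E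
  proof -
    have "(\<lambda>h. h \<bullet> E) = (\<lambda>h. h \<bullet> adjoint f' 1)"
      using that D has_derivative_unique unfolding gderiv_def by blast
    then show ?thesis by (metis inner_commute vector_eq_ldot)
  qed
  with D show ?thesis unfolding grad_def by (metis theI)
qed

text \<open>The value \<open>\<infinity>\<close> means that \<open>g\<close> is not Lipschitz continuous on \<open>B\<close>.\<close>

definition Lip :: "'a::real_normed_vector set \<Rightarrow> ('a \<Rightarrow> 'b::real_normed_vector) \<Rightarrow> ennreal" where
  "Lip B g = (SUP (X, Y) \<in> {(X, Y). X \<in> B \<and> Y \<in> B \<and> X \<noteq> Y}.
     ennreal (norm (g X - g Y) / norm (X - Y)))"

text \<open>A closed ball of a nontrivial normed space is always a proper subset.\<close>

definition locally_Lipschitz :: "('a::real_normed_vector \<Rightarrow> 'b::real_normed_vector) \<Rightarrow> bool" where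
  "locally_Lipschitz g \<longleftrightarrow> (\<forall>C \<rho>. Lip (cball C \<rho>) g < \<infinity>)"


subsection \<open>Projection, tangent cone, low-rank matrices\<close>

definition proj :: "'a::real_normed_vector set \<Rightarrow> 'a \<Rightarrow> 'a set" where
  "proj S X = {Y. is_arg_min (\<lambda>Y. norm (X - Y)) (\<lambda>Y. Y \<in> S) Y}"

definition tangent_cone :: "'a::real_normed_vector set \<Rightarrow> 'a \<Rightarrow> 'a set" where
  "tangent_cone S X = {Z. \<exists>Xs t. (\<forall>i::nat. Xs i \<in> S) \<and> (\<forall>i. 0 < t i) \<and> Xs \<longlonglongrightarrow> X \<and>
     (\<lambda>i. (Xs i - X) /\<^sub>R t i) \<longlonglongrightarrow> Z}"

definition rank_le :: "nat \<Rightarrow> (real^'n^'m) set" where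
  "rank_le r = {X. rank X \<le> r}"

definition rank_eq :: "nat \<Rightarrow> (real^'n^'m) set" where
  "rank_eq r = {X. rank X = r}"

text \<open>The projection of a point onto a closed cone is nonempty and all its elements have the same
  norm, so the definite description is well defined.\<close>

definition stat :: "(real^'n^'m \<Rightarrow> real) \<Rightarrow> (real^'n^'m) set \<Rightarrow> real^'n^'m \<Rightarrow> real" where
  "stat f S X = (THE t. norm ` proj (tangent_cone S X) (- grad f X) = {t})"


subsection \<open>Singular values\<close>

definition charpoly :: "real^'n^'n \<Rightarrow> real poly" where
  "charpoly A = det (\<chi> i j. (if i = j then [:0, 1:] else 0) - [:A $ i $ j:])"

text \<open>
  \<open>sing_val j X\<close> is the \<open>j\<close>-th largest singular value, counted from 1: the square root of the \<open>j\<close>-th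
  largest eigenvalue, with multiplicity, of \<open>X\<^sup>T X\<close>. That matrix is symmetric, so its
  characteristic polynomial splits over the reals and the list below has length \<open>CARD('n)\<close>. Only
  indices \<open>1 \<le> j \<le> min CARD('m) CARD('n)\<close> are meaningful.
\<close>

definition sing_val :: "nat \<Rightarrow> real^'n^'m \<Rightarrow> real" where
  "sing_val j X =
     sqrt (rev (sorted_list_of_multiset (proots (charpoly (transpose X ** X)))) ! (j - 1))"


subsection \<open>The ERFD and ERFDR maps\<close>

text \<open>\<open>while_option\<close> is \<open>None\<close> on a run that does not terminate; such a run yields no output.\<close>

definition ERFD :: "(real^'n^'m \<Rightarrow> real) \<Rightarrow> nat \<Rightarrow> real \<Rightarrow> real \<Rightarrow> real \<Rightarrow> real \<Rightarrow> real \<Rightarrow> real \<Rightarrow>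
    real^'n^'m \<Rightarrow> (real^'n^'m) set" where
  "ERFD f r \<alpha>lo \<alpha>hi \<beta> c \<kappa>1 \<kappa>2 X = {Y. \<exists>G \<alpha> \<alpha>'.
     G \<bullet> (- grad f X) \<ge> max (\<kappa>1 * (stat f (rank_le r) X)\<^sup>2) (\<kappa>2 * (norm G)\<^sup>2) \<and>
     (\<forall>a\<in>{0..\<alpha>hi}. X + a *\<^sub>R G \<in> rank_le r) \<and>
     \<alpha> \<in> {\<alpha>lo..\<alpha>hi} \<and>
     while_option (\<lambda>a. f (X + a *\<^sub>R G) > f X + c * a * (grad f X \<bullet> G)) (\<lambda>a. a * \<beta>) \<alpha> = Some \<alpha>' \<and>
     Y = X + \<alpha>' *\<^sub>R G}"

definition ERFDR :: "(real^'n^'m \<Rightarrow> real) \<Rightarrow> nat \<Rightarrow> real \<Rightarrow> real \<Rightarrow> real \<Rightarrow> real \<Rightarrow> real \<Rightarrow> real \<Rightarrow>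
    real \<Rightarrow> real^'n^'m \<Rightarrow> (real^'n^'m) set" where
  "ERFDR f r \<alpha>lo \<alpha>hi \<beta> c \<kappa>1 \<kappa>2 \<Delta> X = {Y. \<exists>Xt \<in> ERFD f r \<alpha>lo \<alpha>hi \<beta> c \<kappa>1 \<kappa>2 X.
     if sing_val r X \<in> {0<..\<Delta>}
     then \<exists>Xh \<in> proj (rank_eq (r - 1)) X. \<exists>XR \<in> ERFD f r \<alpha>lo \<alpha>hi \<beta> c \<kappa>1 \<kappa>2 Xh.
            is_arg_min f (\<lambda>Z. Z \<in> {Xt, XR}) Y
     else Y = Xt}"

text \<open>Infinite sequences generated by the algorithm, i.e. runs whose stopping test never succeeds.\<close>

definition ERFDR_seq :: "(real^'n^'m \<Rightarrow> real) \<Rightarrow> nat \<Rightarrow> real \<Rightarrow> real \<Rightarrow> real \<Rightarrow> real \<Rightarrow> real \<Rightarrow> real \<Rightarrow>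
    real \<Rightarrow> (nat \<Rightarrow> real^'n^'m) \<Rightarrow> bool" where
  "ERFDR_seq f r \<alpha>lo \<alpha>hi \<beta> c \<kappa>1 \<kappa>2 \<Delta> X \<longleftrightarrow>
     X 0 \<in> rank_le r \<and>
     (\<forall>i. stat f (rank_le r) (X i) > 0 \<and>
          (\<exists>\<Delta>i\<ge>\<Delta>. X (Suc i) \<in> ERFDR f r \<alpha>lo \<alpha>hi \<beta> c \<kappa>1 \<kappa>2 \<Delta>i (X i)))"


subsection \<open>Quantities in the complexity bound\<close>

definition radius :: "(real^'n^'m \<Rightarrow> real) \<Rightarrow> real \<Rightarrow> real \<Rightarrow> real^'n^'m \<Rightarrow> real^'n^'m \<Rightarrow> real" where
  "radius f \<alpha>hi \<kappa>2 X0 X = norm (X - X0) + \<alpha>hi / \<kappa>2 * norm (grad f X)"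

text \<open>
  The minimum of \<open>\<alpha>lo\<close> and \<open>2 \<beta> \<kappa>2 (1 - c) / L\<close>. A positive number divided by \<open>0\<close> is \<open>\<infinity>\<close> in
  \<open>ennreal\<close>, so the value is \<open>\<alpha>lo\<close> when \<open>L = 0\<close>.
\<close>

definition min_step :: "real \<Rightarrow> real \<Rightarrow> real \<Rightarrow> real \<Rightarrow> ennreal \<Rightarrow> real" where
  "min_step \<alpha>lo \<beta> c \<kappa>2 L = enn2real (min (ennreal \<alpha>lo) (ennreal (2 * \<beta> * \<kappa>2 * (1 - c)) / L))"

lemma min_step_0:
  assumes "0 \<le> \<alpha>lo" "0 < \<beta>" "c < 1" "0 < \<kappa>2"
  shows "min_step \<alpha>lo \<beta> c \<kappa>2 0 = \<alpha>lo"
  using assms by (simp add: min_step_def ennreal_divide_zero)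

lemma min_step_ennreal:
  assumes "0 \<le> \<alpha>lo" "0 < \<beta>" "c < 1" "0 < \<kappa>2" "0 < L"
  shows "min_step \<alpha>lo \<beta> c \<kappa>2 (ennreal L) = min \<alpha>lo (2 * \<beta> * \<kappa>2 * (1 - c) / L)"
  using assms by (auto simp: min_step_def divide_ennreal min_def ennreal_le_iff2)

end

theory Submission
  imports Defs
begin

text \<open>
  Everything rests on one inequality. Fix an iterate \<open>X\<close> with stationarity measure \<open>s > 0\<close> and let \<open>G\<close>
  be the direction chosen there. The condition on \<open>G\<close> gives \<open>\<langle>-\<nabla>f(X), G\<rangle> \<ge> \<kappa>1 s\<^sup>2 > 0\<close>, so \<open>G\<close> is a
  nonzero descent direction; combined with the Cauchy-Schwarz inequality it also gives
  \<open>\<parallel>G\<parallel> \<le> \<parallel>\<nabla>f(X)\<parallel> / \<kappa>2\<close>, so every trial point of the line search lies in the ball around \<open>X\<^sub>0\<close> whose radius is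
  \<open>\<parallel>X - X\<^sub>0\<parallel> + (\<alpha>hi / \<kappa>2) \<parallel>\<nabla>f(X)\<parallel>\<close>. On that ball the gradient has a finite Lipschitz constant \<open>L\<close>, and
  the quadratic upper bound for \<open>f\<close> shows that a rejected step size exceeds \<open>2 \<kappa>2 (1 - c) / L\<close>. The
  accepted step size is either the initial one or \<open>\<beta>\<close> times a rejected one, hence at least \<open>min_step\<close>, and the sufficient decrease condition turns this
  into a decrease of \<open>f\<close> by at least \<open>c \<kappa>1 min_step s\<^sup>2\<close> (lemma \<open>ERFD_decrease\<close>).

  The rank reduction step can only lower the value of \<open>f\<close> further, so the decrease holds along the
  whole sequence, in particular the values \<open>f(X\<^sub>i)\<close> are strictly decreasing. Along a bounded subsequence
  one radius, hence one \<open>min_step\<close>, serves all iterates, and the decreases telescope: decreases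
  between consecutive elements of the subsequence that are not accounted for only help. This is lemma
  \<open>ERFDR_sum_stat_squares_less\<close>; it is strict because the values never attain their infimum.
  The remaining claims are consequences of this summability, of monotonicity and of the continuity of
  \<open>f\<close>. A bounded initial sublevel set makes the sequence bounded because the line search stays in
  \<open>rank_le r\<close> by the choice of \<open>G\<close>, so that all iterates lie in that set.
\<close>

section \<open>Functions with Lipschitz gradient\<close>

lemma norm_diff_le_Lip:
  assumes "Lip B g < \<infinity>" "X \<in> B" "Y \<in> B"
  shows "norm (g X - g Y) \<le> enn2real (Lip B g) * norm (X - Y)"
proof (cases "X = Y")
  case False
  have "ennreal (norm (g X - g Y) / norm (X - Y)) \<le> Lip B g"
    unfolding Lip_def by (rule SUP_upper2[of "(X, Y)"]) (use assms False in auto)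
  also have "Lip B g = ennreal (enn2real (Lip B g))"
    using assms(1) by simp
  finally have "norm (g X - g Y) / norm (X - Y) \<le> enn2real (Lip B g)"
    by simp
  then show ?thesis
    using False by (simp add: field_simps)
qed simp

text \<open>
  The first-order Taylor error along the segment, minus the quadratic \<open>L/2 t\<^sup>2 \<parallel>Y - X\<parallel>\<^sup>2\<close>, vanishes at
  \<open>t = 0\<close> and has nonpositive derivative, by the Cauchy-Schwarz inequality.
\<close>

lemma quadratic_upper_bound:
  fixes f :: "'a::euclidean_space \<Rightarrow> real"
  assumes diff: "\<And>Z. f differentiable (at Z)"
    and lip: "\<And>Z. Z \<in> closed_segment X Y \<Longrightarrow> norm (grad f Z - grad f X) \<le> L * norm (Z - X)"
  shows "f Y \<le> f X + grad f X \<bullet> (Y - X) + L / 2 * (norm (Y - X))\<^sup>2"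
proof -
  define H where "H = Y - X"
  define g where "g t = f (X + t *\<^sub>R H) - t * (grad f X \<bullet> H) - L / 2 * t\<^sup>2 * (norm H)\<^sup>2" for t
  have f': "((\<lambda>t. f (X + t *\<^sub>R H)) has_real_derivative (grad f (X + t *\<^sub>R H) \<bullet> H)) (at t)" for t
  proof -
    have line: "((\<lambda>t. X + t *\<^sub>R H) has_derivative (\<lambda>h. h *\<^sub>R H)) (at t)"
      by (auto intro!: derivative_eq_intros)
    have "(f has_derivative (\<lambda>h. h \<bullet> grad f Z)) (at Z)" for Z
      using GDERIV_grad[OF diff] by (simp add: gderiv_def)
    from has_derivative_compose[OF line this] show ?thesis
      unfolding has_field_derivative_def
      by (rule has_derivative_eq_rhs) (simp add: inner_commute fun_eq_iff mult.commute)
  qed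
  have g': "(g has_real_derivative
      (grad f (X + t *\<^sub>R H) \<bullet> H - grad f X \<bullet> H - L * t * (norm H)\<^sup>2)) (at t)" for t
    unfolding g_def by (auto intro!: derivative_eq_intros f')
  have "g 1 \<le> g 0"
  proof (rule DERIV_nonpos_imp_nonincreasing[of 0 1 g])
    fix t :: real assume t: "0 \<le> t" "t \<le> 1"
    have seg: "X + t *\<^sub>R H \<in> closed_segment X Y"
      unfolding in_segment using t by (auto simp: H_def algebra_simps)
    have "grad f (X + t *\<^sub>R H) \<bullet> H - grad f X \<bullet> H \<le> norm (grad f (X + t *\<^sub>R H) - grad f X) * norm H"
      unfolding inner_diff_left[symmetric] by (rule norm_cauchy_schwarz)
    also have "\<dots> \<le> (L * (t * norm H)) * norm H"
      using lip[OF seg] t by (intro mult_right_mono) auto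
    finally have "grad f (X + t *\<^sub>R H) \<bullet> H - grad f X \<bullet> H - L * t * (norm H)\<^sup>2 \<le> 0"
      by (simp add: power2_eq_square mult.assoc)
    then show "\<exists>y. (g has_real_derivative y) (at t) \<and> y \<le> 0"
      using g' by blast
  qed simp
  then show ?thesis by (simp add: g_def H_def)
qed

lemma bounded_grad_image:
  fixes f :: "'a::euclidean_space \<Rightarrow> real"
  assumes "locally_Lipschitz (grad f)" "bounded S"
  shows "bounded (grad f ` S)"
proof -
  obtain \<rho> where \<rho>: "\<And>Z. Z \<in> S \<Longrightarrow> norm Z \<le> \<rho>" "0 < \<rho>"
    using assms(2) bounded_pos by blast
  define K where "K = enn2real (Lip (cball 0 \<rho>) (grad f))"
  have fin: "Lip (cball 0 \<rho>) (grad f) < \<infinity>"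
    using assms(1) by (auto simp: locally_Lipschitz_def)
  have "norm (grad f Z) \<le> norm (grad f 0) + K * \<rho>" if "Z \<in> S" for Z
  proof -
    have "norm (grad f Z - grad f 0) \<le> K * norm (Z - 0)"
      unfolding K_def using \<rho> that by (intro norm_diff_le_Lip[OF fin]) auto
    also have "\<dots> \<le> K * \<rho>"
      using \<rho>(1)[OF that] by (auto intro!: mult_left_mono simp: K_def)
    finally show ?thesis
      using norm_triangle_ineq2[of "grad f Z" "grad f 0"] by linarith
  qed
  then show ?thesis unfolding bounded_iff by blast
qed

lemma bdd_below_image_bounded:
  fixes f :: "'a::euclidean_space \<Rightarrow> real"
  assumes "continuous_on UNIV f" "bounded S"
  shows "bdd_below (f ` S)"
proof -
  have "compact (f ` closure S)"
    using assms by (intro compact_continuous_image) (auto intro: continuous_on_subset)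
  then have "bdd_below (f ` closure S)"
    by (intro bounded_imp_bdd_below compact_imp_bounded)
  then show ?thesis
    by (rule bdd_below_mono) (auto intro: closure_subset[THEN subsetD])
qed

section \<open>The backtracking line search\<close>

text \<open>
  The last alternative records the step size rejected just before the accepted one: it is the
  source of the lower bound on accepted step sizes.
\<close>

lemma backtracking_result:
  fixes \<alpha> \<alpha>' \<beta> :: real
  assumes w: "while_option reject (\<lambda>a. a * \<beta>) \<alpha> = Some \<alpha>'"
    and \<beta>: "0 < \<beta>" "\<beta> < 1" and \<alpha>: "0 < \<alpha>"
  shows "\<not> reject \<alpha>'" "0 < \<alpha>'" "\<alpha>' \<le> \<alpha>"
    and "\<alpha>' = \<alpha> \<or> \<alpha>' / \<beta> \<le> \<alpha> \<and> reject (\<alpha>' / \<beta>)"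
proof -
  let ?P = "\<lambda>a. 0 < a \<and> a \<le> \<alpha> \<and> (a = \<alpha> \<or> a / \<beta> \<le> \<alpha> \<and> reject (a / \<beta>))"
  show "\<not> reject \<alpha>'" using while_option_stop[OF w] .
  have "?P \<alpha>'"
  proof (rule while_option_rule[OF _ w, where P = ?P])
    fix a assume a: "?P a" "reject a"
    have "a * \<beta> \<le> a" using a \<beta> by (simp add: mult_left_le)
    then have "a * \<beta> \<le> \<alpha>" using a by linarith
    then show "?P (a * \<beta>)" using a \<beta> by simp
  qed (use \<alpha> in auto)
  then show "0 < \<alpha>'" "\<alpha>' \<le> \<alpha>" "\<alpha>' = \<alpha> \<or> \<alpha>' / \<beta> \<le> \<alpha> \<and> reject (\<alpha>' / \<beta>)" by auto
qed

lemma min_step_finite: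
  assumes "0 < \<alpha>lo" "0 < \<beta>" "c < 1" "0 < \<kappa>2" "L < \<infinity>"
  shows "min_step \<alpha>lo \<beta> c \<kappa>2 L =
    (if enn2real L = 0 then \<alpha>lo else min \<alpha>lo (2 * \<beta> * \<kappa>2 * (1 - c) / enn2real L))"
proof (cases "enn2real L = 0")
  case True
  then have "L = 0" using assms(5) by (auto simp: enn2real_eq_0_iff)
  then show ?thesis using assms by (simp add: min_step_0)
next
  case False
  then have "0 < enn2real L" by (simp add: order_less_le)
  moreover have "L = ennreal (enn2real L)" using assms(5) by simp
  ultimately show ?thesis
    using assms False min_step_ennreal[of \<alpha>lo \<beta> c \<kappa>2 "enn2real L"] by simp
qed

lemma min_step_pos:
  assumes "0 < \<alpha>lo" "0 < \<beta>" "c < 1" "0 < \<kappa>2" "L < \<infinity>"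
  shows "0 < min_step \<alpha>lo \<beta> c \<kappa>2 L"
proof (cases "enn2real L = 0")
  case False
  then have "0 < enn2real L" by (simp add: order_less_le)
  then show ?thesis using assms by (simp add: min_step_finite)
qed (use assms in \<open>simp add: min_step_finite\<close>)

text \<open>
  At a rejected step size \<open>a\<close> the function lies above the line of slope \<open>c \<langle>\<nabla>f(X), G\<rangle>\<close> but below the
  quadratic upper bound. Comparing the two leaves \<open>(1 - c) \<langle>-\<nabla>f(X), G\<rangle> < L/2 a \<parallel>G\<parallel>\<^sup>2\<close>, and the left-hand
  side is at least \<open>(1 - c) \<kappa>2 \<parallel>G\<parallel>\<^sup>2\<close>.
\<close>

lemma rejected_step_lower_bound:
  fixes f :: "'a::euclidean_space \<Rightarrow> real"
  assumes diff: "\<And>Z. f differentiable (at Z)"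
    and lip: "\<And>Z. Z \<in> closed_segment X (X + a *\<^sub>R G) \<Longrightarrow>
        norm (grad f Z - grad f X) \<le> L * norm (Z - X)"
    and G: "\<kappa>2 * (norm G)\<^sup>2 \<le> G \<bullet> (- grad f X)" "G \<noteq> 0"
    and reject: "f (X + a *\<^sub>R G) > f X + c * a * (grad f X \<bullet> G)"
    and "0 < a" "c < 1"
  shows "2 * \<kappa>2 * (1 - c) < L * a"
proof -
  let ?q = "G \<bullet> (- grad f X)"
  have "f (X + a *\<^sub>R G) \<le> f X + grad f X \<bullet> (a *\<^sub>R G) + L / 2 * (norm (a *\<^sub>R G))\<^sup>2"
    using quadratic_upper_bound[of f X "X + a *\<^sub>R G" L, OF diff lip] by simp
  then have "a * ((1 - c) * ?q) < a * (L / 2 * a * (norm G)\<^sup>2)"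
    using reject by (simp add: inner_commute power_mult_distrib algebra_simps power2_eq_square)
  then have "(1 - c) * ?q < L / 2 * a * (norm G)\<^sup>2"
    using mult_less_cancel_left_pos[OF \<open>0 < a\<close>] by blast
  moreover have "(1 - c) * (\<kappa>2 * (norm G)\<^sup>2) \<le> (1 - c) * ?q"
    using G \<open>c < 1\<close> by (intro mult_left_mono) auto
  ultimately have "((1 - c) * \<kappa>2) * (norm G)\<^sup>2 < (L / 2 * a) * (norm G)\<^sup>2"
    by (simp add: algebra_simps)
  then have "(1 - c) * \<kappa>2 < L / 2 * a"
    using G(2) by (simp add: mult_less_cancel_right)
  then show ?thesis by (simp add: algebra_simps)
qed

section \<open>Decrease of the cost function\<close>

lemma ERFD_subset_rank_le:
  assumes "Y \<in> ERFD f r \<alpha>lo \<alpha>hi \<beta> c \<kappa>1 \<kappa>2 X" "0 < \<alpha>lo" "0 < \<beta>" "\<beta> < 1"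
  shows "Y \<in> rank_le r"
proof -
  obtain G \<alpha> \<alpha>' where G: "\<forall>a\<in>{0..\<alpha>hi}. X + a *\<^sub>R G \<in> rank_le r"
    and \<alpha>: "\<alpha> \<in> {\<alpha>lo..\<alpha>hi}"
    and w: "while_option (\<lambda>a. f (X + a *\<^sub>R G) > f X + c * a * (grad f X \<bullet> G)) (\<lambda>a. a * \<beta>) \<alpha> = Some \<alpha>'"
    and Y: "Y = X + \<alpha>' *\<^sub>R G"
    using assms(1) unfolding ERFD_def by blast
  have "0 < \<alpha>'" "\<alpha>' \<le> \<alpha>"
    using backtracking_result[OF w] assms \<alpha> by auto
  then show ?thesis using G \<alpha> Y by auto
qed

lemma ERFD_decrease:
  fixes f :: "real^'n^'m \<Rightarrow> real"
  assumes Y: "Y \<in> ERFD f r \<alpha>lo \<alpha>hi \<beta> c \<kappa>1 \<kappa>2 X"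
    and s: "0 < stat f (rank_le r) X"
    and diff: "\<And>Z. f differentiable (at Z)"
    and fin: "Lip (cball C \<rho>) (grad f) < \<infinity>"
    and \<rho>: "radius f \<alpha>hi \<kappa>2 C X \<le> \<rho>"
    and par: "0 < \<alpha>lo" "0 < \<beta>" "\<beta> < 1" "0 < c" "c < 1" "0 < \<kappa>1" "0 < \<kappa>2"
  shows "c * \<kappa>1 * min_step \<alpha>lo \<beta> c \<kappa>2 (Lip (cball C \<rho>) (grad f)) * (stat f (rank_le r) X)\<^sup>2
    \<le> f X - f Y"
proof -
  define s where "s = stat f (rank_le r) X"
  define L where "L = enn2real (Lip (cball C \<rho>) (grad f))"
  define \<mu> where "\<mu> = min_step \<alpha>lo \<beta> c \<kappa>2 (Lip (cball C \<rho>) (grad f))"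
  obtain G \<alpha> \<alpha>' where G: "\<kappa>1 * s\<^sup>2 \<le> G \<bullet> (- grad f X)" "\<kappa>2 * (norm G)\<^sup>2 \<le> G \<bullet> (- grad f X)"
    and \<alpha>: "\<alpha> \<in> {\<alpha>lo..\<alpha>hi}"
    and w: "while_option (\<lambda>a. f (X + a *\<^sub>R G) > f X + c * a * (grad f X \<bullet> G)) (\<lambda>a. a * \<beta>) \<alpha> = Some \<alpha>'"
    and Y: "Y = X + \<alpha>' *\<^sub>R G"
    using Y unfolding ERFD_def s_def by auto
  have \<alpha>0: "0 < \<alpha>" using \<alpha> par by auto
  note bt = backtracking_result[OF w \<open>0 < \<beta>\<close> \<open>\<beta> < 1\<close> \<alpha>0]
  have "0 < \<kappa>1 * s\<^sup>2" using s par by (simp add: s_def)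
  with G(1) have G0: "G \<noteq> 0" by auto
  have "\<kappa>2 * norm G * norm G \<le> norm (grad f X) * norm G"
    using G(2) norm_cauchy_schwarz[of G "- grad f X"] by (simp add: power2_eq_square mult_ac)
  then have normG: "norm G \<le> norm (grad f X) / \<kappa>2"
    using G0 par by (simp add: field_simps)
  have trial_in_ball: "X + a *\<^sub>R G \<in> cball C \<rho>" if a: "0 \<le> a" "a \<le> \<alpha>hi" for a
  proof -
    have "norm (X + a *\<^sub>R G - C) \<le> norm (X - C) + a * norm G"
      using norm_triangle_ineq[of "X - C" "a *\<^sub>R G"] a by (simp add: algebra_simps)
    also have "a * norm G \<le> \<alpha>hi * (norm (grad f X) / \<kappa>2)"
      using a normG by (intro mult_mono) auto
    finally show ?thesis
      using \<rho> by (simp add: radius_def dist_norm norm_minus_commute)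
  qed
  have lip: "norm (grad f Z - grad f X) \<le> L * norm (Z - X)"
    if "Z \<in> closed_segment X (X + a *\<^sub>R G)" "0 \<le> a" "a \<le> \<alpha>hi" for Z a
  proof -
    have "X \<in> cball C \<rho>" "X + a *\<^sub>R G \<in> cball C \<rho>"
      using trial_in_ball[of 0] trial_in_ball[of a] that by auto
    moreover from this have "Z \<in> cball C \<rho>"
      using closed_segment_subset[OF _ _ convex_cball] that(1) by blast
    ultimately show ?thesis
      unfolding L_def by (intro norm_diff_le_Lip[OF fin])
  qed
  have "\<mu> \<le> \<alpha>'"
    using bt(4)
  proof
    assume "\<alpha>' = \<alpha>"
    then show ?thesis
      using \<alpha> par fin by (auto simp: \<mu>_def min_step_finite)
  next
    assume a: "\<alpha>' / \<beta> \<le> \<alpha> \<and> f (X + (\<alpha>' / \<beta>) *\<^sub>R G) > f X + c * (\<alpha>' / \<beta>) * (grad f X \<bullet> G)"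
    have pos: "0 < \<alpha>' / \<beta>" "\<alpha>' / \<beta> \<le> \<alpha>hi" using bt(2) par a \<alpha> by auto
    have less: "2 * \<kappa>2 * (1 - c) < L * (\<alpha>' / \<beta>)"
      by (rule rejected_step_lower_bound[OF diff _ G(2) G0]) (use lip pos a par in auto)
    (* If the gradient is constant on the ball, no step size is ever rejected. *)
    moreover have "0 < 2 * \<kappa>2 * (1 - c)" using par by simp
    ultimately have "L \<noteq> 0" by auto
    then have L: "0 < L" by (simp add: L_def order_less_le)
    have "2 * \<beta> * \<kappa>2 * (1 - c) / L \<le> \<alpha>'"
      using less L par by (simp add: field_simps)
    then show ?thesis
      using L par fin by (auto simp: \<mu>_def min_step_finite L_def[symmetric])
  qed
  have "c * \<kappa>1 * \<mu> * s\<^sup>2 = c * \<mu> * (\<kappa>1 * s\<^sup>2)" by simp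
  also have "\<dots> \<le> c * \<alpha>' * (\<kappa>1 * s\<^sup>2)"
    using \<open>\<mu> \<le> \<alpha>'\<close> par \<open>0 < \<kappa>1 * s\<^sup>2\<close> by (intro mult_right_mono mult_left_mono) auto
  also have "\<dots> \<le> c * \<alpha>' * (G \<bullet> (- grad f X))"
    using G(1) par bt(2) by (intro mult_left_mono) auto
  also have "\<dots> \<le> f X - f Y"
    using bt(1) Y by (simp add: inner_commute)
  finally show ?thesis by (simp add: \<mu>_def s_def)
qed

text \<open>
  The returned point has a value of at most that of the point found without rank reduction, so \<open>ERFDR\<close>
  inherits lower bounds on the decrease from \<open>ERFD\<close>.
\<close>

lemma ERFDR_le_ERFD:
  assumes "Y \<in> ERFDR f r \<alpha>lo \<alpha>hi \<beta> c \<kappa>1 \<kappa>2 \<Delta> X"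
  obtains Xt where "Xt \<in> ERFD f r \<alpha>lo \<alpha>hi \<beta> c \<kappa>1 \<kappa>2 X" "f Y \<le> f Xt"
  using assms unfolding ERFDR_def is_arg_min_def
  by (auto split: if_splits simp: not_less)

lemma ERFDR_subset_rank_le:
  assumes "Y \<in> ERFDR f r \<alpha>lo \<alpha>hi \<beta> c \<kappa>1 \<kappa>2 \<Delta> X" "0 < \<alpha>lo" "0 < \<beta>" "\<beta> < 1"
  shows "Y \<in> rank_le r"
  using assms(1) ERFD_subset_rank_le[OF _ assms(2-4)]
  unfolding ERFDR_def is_arg_min_def by (fastforce split: if_splits)

section \<open>Sequences generated by the algorithm\<close>

context
  fixes f :: "real^'n^'m \<Rightarrow> real"
    and X :: "nat \<Rightarrow> real^'n^'m"
    and r :: nat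
    and \<alpha>lo \<alpha>hi \<beta> c \<kappa>1 \<kappa>2 \<Delta> :: real
  assumes diff: "\<And>Z. f differentiable (at Z)"
    and lipschitz: "locally_Lipschitz (grad f)"
    and par: "0 < \<alpha>lo" "\<alpha>lo \<le> \<alpha>hi" "0 < \<beta>" "\<beta> < 1" "0 < c" "c < 1" "0 < \<kappa>1" "0 < \<kappa>2"
    and X: "ERFDR_seq f r \<alpha>lo \<alpha>hi \<beta> c \<kappa>1 \<kappa>2 \<Delta> X"
begin

abbreviation (input) "s i \<equiv> stat f (rank_le r) (X i)"

abbreviation (input) "decrease_factor \<rho> \<equiv>
  c * \<kappa>1 * min_step \<alpha>lo \<beta> c \<kappa>2 (Lip (cball (X 0) \<rho>) (grad f))"

lemma stat_pos: "0 < s i"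
  using X by (simp add: ERFDR_seq_def)

lemma decrease_factor_pos: "0 < decrease_factor \<rho>"
  using min_step_pos[of \<alpha>lo \<beta> c \<kappa>2 "Lip (cball (X 0) \<rho>) (grad f)"] par lipschitz
  by (auto simp: locally_Lipschitz_def)

lemma ERFDR_seq_rank_le: "X i \<in> rank_le r"
proof (cases i)
  case (Suc j)
  then show ?thesis
    using X ERFDR_subset_rank_le[OF _ par(1,3,4)] unfolding ERFDR_seq_def by blast
qed (use X in \<open>simp add: ERFDR_seq_def\<close>)

lemma ERFDR_seq_decrease:
  assumes "radius f \<alpha>hi \<kappa>2 (X 0) (X i) \<le> \<rho>"
  shows "decrease_factor \<rho> * (s i)\<^sup>2 \<le> f (X i) - f (X (Suc i))"
proof -
  obtain \<Delta>i where "X (Suc i) \<in> ERFDR f r \<alpha>lo \<alpha>hi \<beta> c \<kappa>1 \<kappa>2 \<Delta>i (X i)"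
    using X by (auto simp: ERFDR_seq_def)
  then obtain Xt where Xt: "Xt \<in> ERFD f r \<alpha>lo \<alpha>hi \<beta> c \<kappa>1 \<kappa>2 (X i)" "f (X (Suc i)) \<le> f Xt"
    by (rule ERFDR_le_ERFD)
  have "Lip (cball (X 0) \<rho>) (grad f) < \<infinity>"
    using lipschitz by (simp add: locally_Lipschitz_def)
  from ERFD_decrease[OF Xt(1) stat_pos diff this assms par(1,3-8)] Xt(2)
  show ?thesis by linarith
qed

lemma f_less_Suc: "f (X (Suc i)) < f (X i)"
proof -
  have "0 < decrease_factor (radius f \<alpha>hi \<kappa>2 (X 0) (X i)) * (s i)\<^sup>2"
    using decrease_factor_pos stat_pos[of i] by (intro mult_pos_pos[of "decrease_factor _"]) auto
  then show ?thesis using ERFDR_seq_decrease[of i, OF order_refl] by linarith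
qed

lemma f_less: "i < j \<Longrightarrow> f (X j) < f (X i)"
  using strict_mono_less[of "\<lambda>i. - f (X i)" i j] f_less_Suc by (simp add: strict_mono_Suc_iff)

lemma f_le: "i \<le> j \<Longrightarrow> f (X j) \<le> f (X i)"
  using f_less[of i j] by (cases "i = j") auto

lemma continuous_f: "continuous_on A f"
  using diff by (simp add: continuous_at_imp_continuous_on differentiable_imp_continuous_within)

lemma bdd_above_radius:
  assumes "bounded (range (X \<circ> \<phi>))"
  shows "bdd_above (range (\<lambda>l. radius f \<alpha>hi \<kappa>2 (X 0) (X (\<phi> l))))"
proof -
  obtain A where A: "\<And>l. norm (X (\<phi> l)) \<le> A"
    using assms unfolding bounded_iff by auto
  have "bounded (grad f ` range (X \<circ> \<phi>))"
    using bounded_grad_image[OF lipschitz assms] .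
  then obtain D where D: "\<And>l. norm (grad f (X (\<phi> l))) \<le> D"
    unfolding bounded_iff by auto
  have "radius f \<alpha>hi \<kappa>2 (X 0) (X (\<phi> l)) \<le> (A + norm (X 0)) + \<alpha>hi / \<kappa>2 * D" for l
    unfolding radius_def using A[of l] D[of l] norm_triangle_ineq4[of "X (\<phi> l)" "X 0"] par
    by (intro add_mono mult_left_mono) auto
  then show ?thesis unfolding bdd_above_def by blast
qed

lemma bdd_below_values:
  assumes "bounded (range (X \<circ> \<phi>))"
  shows "bdd_below (range (\<lambda>l. f (X (\<phi> l))))"
  using bdd_below_image_bounded[OF continuous_f assms] by (simp add: image_image)

text \<open>
  Between \<open>X (\<phi> l)\<close> and \<open>X (\<phi> (l + 1))\<close> only the first step is charged with the decrease at
  \<open>X (\<phi> l)\<close>; the other steps do not increase \<open>f\<close>. The final iterate \<open>X (\<phi> (k + 1))\<close> still lies strictly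
  above the infimum.
\<close>

lemma ERFDR_sum_stat_squares_less:
  fixes \<phi> :: "nat \<Rightarrow> nat"
  assumes \<phi>: "strict_mono \<phi>" and bd: "bounded (range (X \<circ> \<phi>))"
  defines "\<rho> \<equiv> (SUP l. radius f \<alpha>hi \<kappa>2 (X 0) (X (\<phi> l)))"
  shows "(\<Sum>l=0..k. (s (\<phi> l))\<^sup>2) < (f (X 0) - (INF l. f (X (\<phi> l)))) / decrease_factor \<rho>"
proof -
  have step: "decrease_factor \<rho> * (s (\<phi> l))\<^sup>2 \<le> f (X (\<phi> l)) - f (X (\<phi> (Suc l)))" for l
  proof -
    have "radius f \<alpha>hi \<kappa>2 (X 0) (X (\<phi> l)) \<le> \<rho>"
      unfolding \<rho>_def by (rule cSUP_upper[OF _ bdd_above_radius[OF bd]]) simp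
    moreover have "f (X (\<phi> (Suc l))) \<le> f (X (Suc (\<phi> l)))"
      using \<phi> by (intro f_le) (simp add: Suc_le_eq strict_mono_Suc_iff)
    ultimately show ?thesis using ERFDR_seq_decrease[of "\<phi> l" \<rho>] by linarith
  qed
  have "decrease_factor \<rho> * (\<Sum>l=0..k. (s (\<phi> l))\<^sup>2) \<le> (\<Sum>l=0..k. f (X (\<phi> l)) - f (X (\<phi> (Suc l))))"
    unfolding sum_distrib_left by (intro sum_mono step)
  also have "\<dots> = f (X (\<phi> 0)) - f (X (\<phi> (Suc k)))"
    by (induction k) auto
  also have "\<dots> \<le> f (X 0) - f (X (\<phi> (Suc k)))"
    using f_le[of 0 "\<phi> 0"] by simp
  also have "\<dots> < f (X 0) - f (X (\<phi> (Suc (Suc k))))"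
    using f_less[of "\<phi> (Suc k)" "\<phi> (Suc (Suc k))"] \<phi> by (simp add: strict_mono_Suc_iff)
  also have "\<dots> \<le> f (X 0) - (INF l. f (X (\<phi> l)))"
    using cINF_lower[OF bdd_below_values[OF bd], of "Suc (Suc k)"] by simp
  finally show ?thesis
    using decrease_factor_pos[of \<rho>] by (simp add: less_divide_eq mult.commute)
qed

lemma values_tendsto_INF:
  fixes \<phi> :: "nat \<Rightarrow> nat"
  assumes "strict_mono \<phi>" "bounded (range (X \<circ> \<phi>))"
  shows "(\<lambda>l. f (X (\<phi> l))) \<longlonglongrightarrow> (INF l. f (X (\<phi> l)))"
proof (rule LIMSEQ_decseq_INF[OF bdd_below_values[OF assms(2)]])
  show "decseq (\<lambda>l. f (X (\<phi> l)))"
    using assms(1) by (auto simp: decseq_def intro!: f_le dest: strict_mono_mono monoD)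
qed

lemma f_accumulation_point:
  assumes "(X \<circ> \<phi>) \<longlonglongrightarrow> A"
  shows "(\<lambda>l. f (X (\<phi> l))) \<longlonglongrightarrow> f A"
  using continuous_on_tendsto_compose[OF continuous_f assms, of UNIV] by (simp add: o_def)

lemma INF_values_eq:
  assumes "strict_mono \<phi>" "bounded (range (X \<circ> \<phi>))" "(X \<circ> \<phi>) \<longlonglongrightarrow> A"
  shows "(INF l. f (X (\<phi> l))) = f A"
  using LIMSEQ_unique values_tendsto_INF f_accumulation_point assms by blast

lemma bounded_if_sublevel_bounded:
  assumes "bounded {Z \<in> rank_le r. f Z \<le> f (X 0)}"
  shows "bounded (range X)"
  by (rule bounded_subset[OF assms]) (auto simp: ERFDR_seq_rank_le f_le)

lemma f_accumulation_points_eq: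
  assumes "bounded (range X)"
    and "strict_mono \<phi>" "(X \<circ> \<phi>) \<longlonglongrightarrow> A" and "strict_mono \<psi>" "(X \<circ> \<psi>) \<longlonglongrightarrow> B"
  shows "f A = f B"
proof -
  have "(\<lambda>i. f (X i)) \<longlonglongrightarrow> (INF i. f (X i))"
    using values_tendsto_INF[of id] assms(1) by (simp add: strict_mono_id)
  note lim = LIMSEQ_subseq_LIMSEQ[OF this]
  from LIMSEQ_unique[OF lim[OF assms(2)]] LIMSEQ_unique[OF lim[OF assms(4)]]
  show ?thesis
    using f_accumulation_point[OF assms(3)] f_accumulation_point[OF assms(5)]
    by (auto simp: o_def)
qed

end

section \<open>Consequences of a uniform bound on sums of squares\<close>

lemma tendsto_0_if_sum_squares_bounded:
  fixes a :: "nat \<Rightarrow> real"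
  assumes "\<And>k. (\<Sum>l=0..k. (a l)\<^sup>2) < M"
  shows "a \<longlonglongrightarrow> 0"
proof -
  have "summable (\<lambda>l. (a l)\<^sup>2)"
  proof (rule bounded_imp_summable)
    show "(\<Sum>l\<le>k. (a l)\<^sup>2) \<le> M" for k
      using assms[of k] by (simp add: atLeast0AtMost)
  qed simp
  then have "(\<lambda>l. (a l)\<^sup>2) \<longlonglongrightarrow> 0" by (rule summable_LIMSEQ_zero)
  from tendsto_real_sqrt[OF this] show ?thesis
    by (simp add: tendsto_rabs_zero_iff)
qed

lemma Min_less_if_sum_squares_less:
  fixes a :: "nat \<Rightarrow> real"
  assumes "(\<Sum>l=0..k. (a l)\<^sup>2) < M" "\<And>l. 0 \<le> a l"
  shows "Min (a ` {0..k}) < 1 / sqrt (real (k + 1)) * sqrt M"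
proof -
  let ?\<mu> = "Min (a ` {0..k})"
  have \<mu>0: "0 \<le> ?\<mu>" using assms(2) by simp
  have "real (k + 1) * ?\<mu>\<^sup>2 = (\<Sum>l=0..k. ?\<mu>\<^sup>2)" by simp
  also have "\<dots> \<le> (\<Sum>l=0..k. (a l)\<^sup>2)"
    using \<mu>0 by (intro sum_mono power_mono Min_le) auto
  also have "\<dots> < M" by fact
  finally have "sqrt (real (k + 1) * ?\<mu>\<^sup>2) < sqrt M" by (rule real_sqrt_less_mono)
  moreover have "sqrt (real (k + 1) * ?\<mu>\<^sup>2) = ?\<mu> * sqrt (real (k + 1))"
    using \<mu>0 by (subst real_sqrt_mult) (simp only: real_sqrt_abs abs_of_nonneg mult.commute)
  ultimately have "?\<mu> * sqrt (real (k + 1)) < sqrt M" by (simp only:)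
  then have "?\<mu> < sqrt M / sqrt (real (k + 1))"
    by (subst pos_less_divide_eq) auto
  then show ?thesis by simp
qed

text \<open>
  All entries before the first one that is at most \<open>\<epsilon>\<close> contribute more than \<open>\<epsilon>\<^sup>2\<close> each to the sum. The
  strictness of the bound \<open>M\<close> on the sums is what allows subtracting \<open>1\<close> from the ceiling.
\<close>

lemma Least_le_if_sum_squares_less:
  fixes a :: "nat \<Rightarrow> real"
  assumes sum: "\<And>k. (\<Sum>l=0..k. (a l)\<^sup>2) < M" and \<epsilon>: "0 < \<epsilon>"
  shows "\<exists>i. a i \<le> \<epsilon>" "int (LEAST i. a i \<le> \<epsilon>) \<le> \<lceil>M / \<epsilon>\<^sup>2\<rceil> - 1"
proof -
  define i where "i = (LEAST i. a i \<le> \<epsilon>)"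
  have "eventually (\<lambda>i. a i < \<epsilon>) sequentially"
    using order_tendstoD(2)[OF tendsto_0_if_sum_squares_bounded[OF sum] \<epsilon>] .
  then show "\<exists>i. a i \<le> \<epsilon>"
    by (auto simp: eventually_sequentially intro: less_imp_le)
  have "real i * \<epsilon>\<^sup>2 = (\<Sum>l\<in>{..<i}. \<epsilon>\<^sup>2)" by simp
  also have "\<dots> \<le> (\<Sum>l\<in>{..<i}. (a l)\<^sup>2)"
  proof (intro sum_mono power_mono)
    fix l assume "l \<in> {..<i}"
    then show "\<epsilon> \<le> a l" using not_less_Least[of l "\<lambda>i. a i \<le> \<epsilon>"] by (simp add: i_def)
  qed (use \<epsilon> in simp)
  also have "\<dots> \<le> (\<Sum>l=0..i. (a l)\<^sup>2)" by (rule sum_mono2) auto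
  also have "\<dots> < M" by (rule sum)
  finally have "real i < M / \<epsilon>\<^sup>2" using \<epsilon> by (simp add: less_divide_eq)
  then have "int i < \<lceil>M / \<epsilon>\<^sup>2\<rceil>" by (simp add: less_ceiling_iff)
  then show "int (LEAST i. a i \<le> \<epsilon>) \<le> \<lceil>M / \<epsilon>\<^sup>2\<rceil> - 1" by (simp add: i_def)
qed

section \<open>Convergence and complexity\<close>

theorem theorem4p3:
  fixes f :: "real^'n^'m \<Rightarrow> real"
    and X :: "nat \<Rightarrow> real^'n^'m"
    and r :: nat
    and \<alpha>lo \<alpha>hi \<beta> c \<kappa>1 \<kappa>2 \<Delta> :: real
  assumes r: "1 \<le> r" "r < min CARD('m) CARD('n)"
    and f: "\<forall>Z. f differentiable (at Z)" "locally_Lipschitz (grad f)"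
    and \<alpha>: "0 < \<alpha>lo" "\<alpha>lo \<le> \<alpha>hi"
    and \<beta>: "\<beta> \<in> {0<..<1}" and c: "c \<in> {0<..<1}"
    and \<kappa>1: "\<kappa>1 \<in> {0<..1/2}" and \<kappa>2: "\<kappa>2 \<in> {0<..1}"
    and \<Delta>: "0 < \<Delta>"
    and X: "ERFDR_seq f r \<alpha>lo \<alpha>hi \<beta> c \<kappa>1 \<kappa>2 \<Delta> X"
  shows
    "(\<forall>\<phi>::nat \<Rightarrow> nat. strict_mono \<phi> \<and> bounded (range (X \<circ> \<phi>)) \<longrightarrow>
        bdd_above (range (\<lambda>l. radius f \<alpha>hi \<kappa>2 (X 0) (X (\<phi> l)))) \<and>
        bdd_below (range (\<lambda>l. f (X (\<phi> l)))) \<and>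
        (let \<rho> = (SUP l. radius f \<alpha>hi \<kappa>2 (X 0) (X (\<phi> l)));
             bound = (f (X 0) - (INF l. f (X (\<phi> l)))) /
                       (c * \<kappa>1 * min_step \<alpha>lo \<beta> c \<kappa>2 (Lip (cball (X 0) \<rho>) (grad f)))
         in (\<forall>k. (\<Sum>l=0..k. (stat f (rank_le r) (X (\<phi> l)))\<^sup>2) < bound) \<and>
            (\<lambda>l. stat f (rank_le r) (X (\<phi> l))) \<longlonglongrightarrow> 0 \<and>
            (\<forall>k. Min ((\<lambda>l. stat f (rank_le r) (X (\<phi> l))) ` {0..k})
                   < 1 / sqrt (real (k + 1)) * sqrt bound)) \<and>
        (\<forall>L\<in>rank_le r. (X \<circ> \<phi>) \<longlonglongrightarrow> L \<longrightarrow> (INF l. f (X (\<phi> l))) = f L))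
     \<and>
     (bounded {Z \<in> rank_le r. f Z \<le> f (X 0)} \<longrightarrow> bounded (range X))
     \<and>
     (bounded (range X) \<longrightarrow>
        (\<forall>A B \<phi> \<psi>. strict_mono (\<phi>::nat \<Rightarrow> nat) \<and> (X \<circ> \<phi>) \<longlonglongrightarrow> A \<and>
                   strict_mono (\<psi>::nat \<Rightarrow> nat) \<and> (X \<circ> \<psi>) \<longlonglongrightarrow> B \<longrightarrow> f A = f B) \<and>
        bdd_above (range (\<lambda>j. radius f \<alpha>hi \<kappa>2 (X 0) (X j))) \<and>
        bdd_below (range (\<lambda>j. f (X j))) \<and>
        (\<forall>\<epsilon>>0.
           let \<rho> = (SUP j. radius f \<alpha>hi \<kappa>2 (X 0) (X j))
           in (\<exists>i. stat f (rank_le r) (X i) \<le> \<epsilon>) \<and>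
              int (LEAST i. stat f (rank_le r) (X i) \<le> \<epsilon>) \<le>
                \<lceil>(f (X 0) - (INF j. f (X j))) /
                  (\<epsilon>\<^sup>2 * c * \<kappa>1 * min_step \<alpha>lo \<beta> c \<kappa>2 (Lip (cball (X 0) \<rho>) (grad f)))\<rceil> - 1))"
proof -
  have diff: "\<And>Z. f differentiable (at Z)" using f by blast
  have par: "0 < \<beta>" "\<beta> < 1" "0 < c" "c < 1" "0 < \<kappa>1" "0 < \<kappa>2"
    using \<beta> c \<kappa>1 \<kappa>2 by auto
  note run = diff f(2) \<alpha> par X
  let ?s = "\<lambda>i. stat f (rank_le r) (X i)"
  have pos: "0 \<le> ?s i" for i using stat_pos[OF run] by (rule less_imp_le)
  note sums = ERFDR_sum_stat_squares_less[OF run]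
  have a: "bdd_above (range (\<lambda>l. radius f \<alpha>hi \<kappa>2 (X 0) (X (\<phi> l)))) \<and>
        bdd_below (range (\<lambda>l. f (X (\<phi> l)))) \<and>
        (let \<rho> = (SUP l. radius f \<alpha>hi \<kappa>2 (X 0) (X (\<phi> l)));
             bound = (f (X 0) - (INF l. f (X (\<phi> l)))) /
                       (c * \<kappa>1 * min_step \<alpha>lo \<beta> c \<kappa>2 (Lip (cball (X 0) \<rho>) (grad f)))
         in (\<forall>k. (\<Sum>l=0..k. (?s (\<phi> l))\<^sup>2) < bound) \<and> (\<lambda>l. ?s (\<phi> l)) \<longlonglongrightarrow> 0 \<and>
            (\<forall>k. Min ((\<lambda>l. ?s (\<phi> l)) ` {0..k}) < 1 / sqrt (real (k + 1)) * sqrt bound)) \<and>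
        (\<forall>L\<in>rank_le r. (X \<circ> \<phi>) \<longlonglongrightarrow> L \<longrightarrow> (INF l. f (X (\<phi> l))) = f L)"
    if "strict_mono \<phi>" "bounded (range (X \<circ> \<phi>))" for \<phi> :: "nat \<Rightarrow> nat"
    unfolding Let_def
    by (intro conjI allI ballI impI bdd_above_radius[OF run that(2)] bdd_below_values[OF run that(2)]
        sums[OF that] tendsto_0_if_sum_squares_bounded[OF sums[OF that]]
        Min_less_if_sum_squares_less[OF sums[OF that] pos] INF_values_eq[OF run that])
  have b: "bdd_above (range (\<lambda>j. radius f \<alpha>hi \<kappa>2 (X 0) (X j))) \<and>
        bdd_below (range (\<lambda>j. f (X j))) \<and>
        (\<forall>\<epsilon>>0.
           let \<rho> = (SUP j. radius f \<alpha>hi \<kappa>2 (X 0) (X j))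
           in (\<exists>i. ?s i \<le> \<epsilon>) \<and>
              int (LEAST i. ?s i \<le> \<epsilon>) \<le>
                \<lceil>(f (X 0) - (INF j. f (X j))) /
                  (\<epsilon>\<^sup>2 * c * \<kappa>1 * min_step \<alpha>lo \<beta> c \<kappa>2 (Lip (cball (X 0) \<rho>) (grad f)))\<rceil> - 1)"
    if bd: "bounded (range X)"
  proof -
    have whole: "strict_mono (\<lambda>j::nat. j)" "bounded (range (X \<circ> (\<lambda>j. j)))"
      using bd by (simp_all add: strict_mono_def o_def)
    show ?thesis
      unfolding Let_def
      using bdd_above_radius[OF run whole(2)] bdd_below_values[OF run whole(2)]
        Least_le_if_sum_squares_less[OF sums[OF whole]]
      by (simp add: mult_ac)
  qed
  have accumulation: "f A = f B"
    if "bounded (range X)" "strict_mono \<phi> \<and> (X \<circ> \<phi>) \<longlonglongrightarrow> A \<and> strict_mono \<psi> \<and> (X \<circ> \<psi>) \<longlonglongrightarrow> B"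
    for A B and \<phi> \<psi> :: "nat \<Rightarrow> nat"
    using f_accumulation_points_eq[OF run that(1)] that(2) by blast
  show ?thesis
  proof (rule conjI[OF _ conjI], goal_cases)
    case 1
    show ?case using a by meson
  next
    case 2
    show ?case using bounded_if_sublevel_bounded[OF run] by (rule impI)
  next
    case 3
    show ?case by (intro impI conjI[OF _ b]) (use accumulation in meson)+
  qed
qed

end
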